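(* Let $\pi\in\Delta(K)$ be an invariant distribution of $M$ (i.e. $\pi M=\pi$), and let $m_1,\dots,m_k\in\Delta(K)$ be the rows of $M$. For $n\ge1$ put $$\Phi_n(\pi)=\pi(1)\,v_n(m_1)+\cdots+\pi(k)\,v_n(m_k).$$ Then the sequence $\{\Phi_n(\pi):n\ge 1\}$ is non-increasing.
   Context: Setting: $K=\{1,\dots,k\}$ is a finite set, $\Delta(K)$ is the set of probability distributions on $K$ (viewed as $k$-dimensional row vectors; $q(i)$ is the mass of $i$ under $q$), $M$ is a $k\times k$ stochastic matrix, and $u:K\times K\to[0,1]$ is a utility function. For a prior $q\in\Delta(K)$, $\{X_j\}_{j\ge1}$ is the Markov chain on $K$ with $X_1\sim q$ and transition matrix $M$. At each stage $j=1,2,\dots$ a decision maker selects an action $\xi_j\in K$ and then observes only the binary signal $I(\xi_j)=\mathbf 1\{X_j=\xi_j\}$. A policy $\xi=(\xi_j)_{j\ge1}$ specifies each action $\xi_j$ as a (deterministic) function of the past actions $\xi_1,\dots,\xi_{j-1}$ and past signals $I(\xi_1),\dots,I(\xi_{j-1})$ (so $\xi_1$ is a fixed element of $K$). Let $\Xi$ be the set of all policies, and let $P_{q,\xi}$, $E_{q,\xi}$ denote the induced probability and expectation. The value of the $n$-stage problem is $$v_n(q)=\max_{\xi\in\Xi}E_{q,\xi}[u(X_n,\xi_n)].$$ *)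

theory Defs
  imports "HOL-Probability.Probability"
begin

text \<open>
  The finite state set is the universe of a type \<open>'k :: finite\<close>, distributions on it are
  \<open>'k pmf\<close>, and a stochastic matrix is given by its rows, so that its \<open>(i, j)\<close> entry is
  \<open>pmf (M i) j\<close>.
  Trajectories \<open>\<omega> :: nat \<Rightarrow> 'k\<close> are indexed from 0 whereas stages are numbered from 1, so the
  definitions below are meaningful only for stages \<open>\<ge> 1\<close>.
\<close>

definition state :: "nat \<Rightarrow> (nat \<Rightarrow> 'k) \<Rightarrow> 'k" where
  "state j \<omega> = \<omega> (j - 1)"

definition chain_kernel ::
    "'k pmf \<Rightarrow> ('k \<Rightarrow> 'k pmf) \<Rightarrow> nat \<Rightarrow> (nat \<Rightarrow> 'k) \<Rightarrow> 'k measure" where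
  "chain_kernel q M i \<omega> = measure_pmf (if i = 0 then q else M (\<omega> (i - 1)))"

text \<open>
  Law of the trajectory, obtained from the Ionescu-Tulcea theorem; \<open>measure_chain_law\<close>
  gives its finite-dimensional distributions. As actions do not influence the chain, this one
  law serves for all policies.
\<close>

definition chain_law :: "'k pmf \<Rightarrow> ('k \<Rightarrow> 'k pmf) \<Rightarrow> (nat \<Rightarrow> 'k) measure" where
  "chain_law q M =
     projective_family.lim UNIV
       (Ionescu_Tulcea.CI (chain_kernel q M) (\<lambda>_. count_space UNIV)) (\<lambda>_. count_space UNIV)"

text \<open>
  A history is the list of past (action, signal) pairs, oldest first. Its length determines
  the stage, so one function on lists encodes the whole sequence of decision rules.
\<close>

type_synonym 'k policy = "('k \<times> bool) list \<Rightarrow> 'k"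

primrec history :: "'k policy \<Rightarrow> (nat \<Rightarrow> 'k) \<Rightarrow> nat \<Rightarrow> ('k \<times> bool) list" where
  "history \<xi> \<omega> 0 = []"
| "history \<xi> \<omega> (Suc j) =
     (let h = history \<xi> \<omega> j; a = \<xi> h in h @ [(a, state (Suc j) \<omega> = a)])"

definition action :: "'k policy \<Rightarrow> nat \<Rightarrow> (nat \<Rightarrow> 'k) \<Rightarrow> 'k" where
  "action \<xi> j \<omega> = \<xi> (history \<xi> \<omega> (j - 1))"

definition payoff ::
    "('k \<Rightarrow> 'k pmf) \<Rightarrow> ('k \<Rightarrow> 'k \<Rightarrow> real) \<Rightarrow> nat \<Rightarrow> 'k pmf \<Rightarrow> 'k policy \<Rightarrow> real" where
  "payoff M u n q \<xi> = (\<integral>\<omega>. u (state n \<omega>) (action \<xi> n \<omega>) \<partial>chain_law q M)"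

text \<open>The maximum is over a finite set by \<open>finite_range_payoff\<close>.\<close>

definition val :: "('k \<Rightarrow> 'k pmf) \<Rightarrow> ('k \<Rightarrow> 'k \<Rightarrow> real) \<Rightarrow> nat \<Rightarrow> 'k pmf \<Rightarrow> real" where
  "val M u n q = Max (range (payoff M u n q))"

definition Phi ::
    "('k::finite \<Rightarrow> 'k pmf) \<Rightarrow> ('k \<Rightarrow> 'k \<Rightarrow> real) \<Rightarrow> nat \<Rightarrow> 'k pmf \<Rightarrow> real" where
  "Phi M u n \<pi> = (\<Sum>i\<in>UNIV. pmf \<pi> i * val M u n (M i))"

definition invariant :: "('k::finite \<Rightarrow> 'k pmf) \<Rightarrow> 'k pmf \<Rightarrow> bool" where
  "invariant M \<pi> \<longleftrightarrow> (\<forall>j. (\<Sum>i\<in>UNIV. pmf \<pi> i * pmf (M i) j) = pmf \<pi> j)"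

lemma Ionescu_Tulcea_chain:
  fixes q :: "'k::finite pmf"
  shows "Ionescu_Tulcea (chain_kernel q M) (\<lambda>_. count_space UNIV)"
proof (rule Ionescu_Tulcea.intro)
  fix i :: nat
  show "chain_kernel q M i \<in> measurable (Pi\<^sub>M {0..<i} (\<lambda>_. count_space UNIV))
          (subprob_algebra (count_space UNIV))"
  proof (cases i)
    case 0
    then show ?thesis
      by (simp add: chain_kernel_def[abs_def] measure_pmf_in_subprob_space
          space_subprob_algebra measure_pmf.subprob_space_axioms)
  next
    case (Suc j)
    have "(\<lambda>x. measure_pmf (M x)) \<in> measurable (count_space UNIV) (subprob_algebra (count_space UNIV))"
      by (simp add: space_subprob_algebra measure_pmf.subprob_space_axioms)
    moreover have "(\<lambda>\<omega>. \<omega> j) \<in> measurable (Pi\<^sub>M {0..<Suc j} (\<lambda>_. count_space UNIV))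
        (count_space (UNIV :: 'k set))"
      by (rule measurable_component_singleton) simp
    ultimately show ?thesis
      unfolding Suc chain_kernel_def[abs_def] by simp
  qed
qed (simp add: chain_kernel_def prob_space_measure_pmf)

lemma sets_chain_law:
  fixes q :: "'k::finite pmf"
  shows "sets (chain_law q M) = sets (Pi\<^sub>M UNIV (\<lambda>_. count_space UNIV))"
proof -
  interpret Ionescu_Tulcea "chain_kernel q M" "\<lambda>_. count_space UNIV"
    by (rule Ionescu_Tulcea_chain)
  show ?thesis unfolding chain_law_def by (rule PF.sets_lim)
qed

lemma prob_space_chain_law:
  fixes q :: "'k::finite pmf"
  shows "prob_space (chain_law q M)"
proof -
  interpret Ionescu_Tulcea "chain_kernel q M" "\<lambda>_. count_space UNIV"
    by (rule Ionescu_Tulcea_chain)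
  have "prob_space (distr PF.lim (Pi\<^sub>M {} (\<lambda>_. count_space UNIV)) (\<lambda>x. restrict x {}))"
    using PF.prob_space_P[of "{}"] distr_lim[of "{}"] by simp
  moreover have "(\<lambda>x. restrict x {}) \<in> measurable PF.lim (Pi\<^sub>M {} (\<lambda>_. count_space UNIV))"
    by (rule measurable_restrict) simp
  ultimately show ?thesis
    unfolding chain_law_def by (rule prob_space_distrD[rotated])
qed

lemma measure_chain_law:
  fixes q :: "'k::finite pmf"
  shows "measure (chain_law q M) {\<omega>. \<forall>i\<le>n. \<omega> i = x i} =
    pmf q (x 0) * (\<Prod>i<n. pmf (M (x i)) (x (Suc i)))"
proof -
  interpret Ionescu_Tulcea "chain_kernel q M" "\<lambda>_. count_space UNIV"
    by (rule Ionescu_Tulcea_chain)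
  let ?S = "\<lambda>n. Pi\<^sub>M {0..<n} (\<lambda>_. count_space (UNIV :: 'k set))"
  let ?A = "\<lambda>n. {restrict x {0..<n}}"
  let ?p = "\<lambda>i. case i of 0 \<Rightarrow> pmf q (x 0) | Suc j \<Rightarrow> pmf (M (x j)) (x (Suc j))"
  have A: "?A n = PiE {0..<n} (\<lambda>i. {x i})" for n
  proof -
    have "PiE {0..<n} (\<lambda>i. {x i}) = PiE {0..<n} (\<lambda>i. {restrict x {0..<n} i})"
      by (rule PiE_cong) simp
    then show ?thesis
      by (simp only: PiE_singleton[OF restrict_extensional])
  qed
  have A_sets[measurable]: "?A n \<in> sets (?S n)" for n
    unfolding A by (rule sets_PiM_I_finite) auto
  have C: "emeasure (C 0 n (\<lambda>_. undefined)) (?A n) = ennreal (\<Prod>i<n. ?p i)" for n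
  proof (induction n)
    case 0
    show ?case
      using emeasure_return[OF A_sets[of 0], of "\<lambda>_. undefined"] by (simp add: restrict_def)
  next
    case (Suc n)
    have e: "emeasure (eP n \<omega>) (?A (Suc n)) = ennreal (?p n) * indicator (?A n) \<omega>"
      if \<omega>: "\<omega> \<in> space (?S n)" for \<omega>
    proof -
      have ext: "\<omega> \<in> extensional {0..<n}"
        using \<omega> by (simp add: space_PiM PiE_iff)
      have eq: "fun_upd \<omega> n y = restrict x {0..<Suc n} \<longleftrightarrow> y = x n \<and> \<omega> = restrict x {0..<n}" for y
        using ext by (auto simp: fun_eq_iff restrict_def extensional_def split: if_splits)
      have "emeasure (eP n \<omega>) (?A (Suc n)) =
          emeasure (chain_kernel q M n \<omega>) {y. y = x n \<and> \<omega> = restrict x {0..<n}}"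
        using emeasure_eP[OF \<omega> A_sets] eq by (simp add: vimage_def)
      also have "\<dots> = ennreal (?p n) * indicator (?A n) \<omega>"
      proof (cases "\<omega> = restrict x {0..<n}")
        case True
        then show ?thesis
          by (cases n) (simp_all add: chain_kernel_def emeasure_pmf_single)
      qed simp
      finally show ?thesis .
    qed
    have "emeasure (C 0 (Suc n) (\<lambda>_. undefined)) (?A (Suc n)) =
        (\<integral>\<^sup>+\<omega>. emeasure (eP n \<omega>) (?A (Suc n)) \<partial>C 0 n (\<lambda>_. undefined))"
      by (subst C.simps, subst emeasure_bind[where N = "?S (Suc n)"])
        (auto simp: space_C space_PiM measurable_cong_sets[OF sets_C] intro!: A_sets)
    also have "\<dots> = (\<integral>\<^sup>+\<omega>. ennreal (?p n) * indicator (?A n) \<omega> \<partial>C 0 n (\<lambda>_. undefined))"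
      by (rule nn_integral_cong) (auto simp: space_C e)
    also have "\<dots> = ennreal (?p n) * emeasure (C 0 n (\<lambda>_. undefined)) (?A n)"
      by (rule nn_integral_cmult_indicator) (simp add: sets_C)
    also have "\<dots> = ennreal (\<Prod>i<Suc n. ?p i)"
      unfolding Suc
      by (subst ennreal_mult[symmetric])
        (auto simp: mult.commute intro!: prod_nonneg split: nat.split)
    finally show ?case .
  qed
  have emb: "{\<omega>. \<forall>i\<le>n. \<omega> i = x i} = PF.emb UNIV {0..<Suc n} (?A (Suc n))"
    by (auto simp: prod_emb_def space_PiM restrict_def fun_eq_iff less_Suc_eq_le) metis
  have "emeasure (chain_law q M) {\<omega>. \<forall>i\<le>n. \<omega> i = x i} = emeasure (CI {0..<Suc n}) (?A (Suc n))"
    unfolding chain_law_def emb by (rule lim) (auto intro: A_sets)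
  also have "\<dots> = emeasure (C 0 (Suc n) (\<lambda>_. undefined)) (?A (Suc n))"
    using emeasure_CI[of "{0..<Suc n}" "Suc n" "?A (Suc n)", OF _ A_sets]
      sets.sets_into_space[OF A_sets[of "Suc n"]] by (simp del: C.simps add: prod_emb_id space_PiM)
  also have "\<dots> = ennreal (\<Prod>i<Suc n. ?p i)"
    by (rule C)
  also have "(\<Prod>i<Suc n. ?p i) = pmf q (x 0) * (\<Prod>i<n. pmf (M (x i)) (x (Suc i)))"
    by (subst prod.lessThan_Suc_shift) simp
  finally show ?thesis
    by (simp add: measure_def prod_nonneg)
qed

lemma length_history [simp]: "length (history \<xi> \<omega> j) = j"
  by (induction j) (simp_all add: Let_def)

lemma finite_range_payoff:
  fixes u :: "'k::finite \<Rightarrow> 'k \<Rightarrow> real"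
  shows "finite (range (payoff M u n q))"
proof -
  let ?L = "{h :: ('k \<times> bool) list. length h < n + 1}"
  have L: "finite ?L"
    using finite_lists_length_le[of "UNIV :: ('k \<times> bool) set" n] by (simp add: less_Suc_eq_le)
  have hist: "history \<xi> \<omega> j = history (restrict \<xi> ?L) \<omega> j" if "j \<le> n" for \<xi> :: "'k policy" and \<omega> j
    using that by (induction j) (auto simp: Let_def)
  have "payoff M u n q \<xi> = payoff M u n q (restrict \<xi> ?L)" for \<xi>
    unfolding payoff_def action_def 
    by (subst hist[of "n - 1" \<xi>]) (auto intro!: Bochner_Integration.integral_cong)
  then have "range (payoff M u n q) \<subseteq> payoff M u n q ` (PiE ?L (\<lambda>_. UNIV))"
    by (intro subsetI, elim rangeE, hypsubst) (metis (no_types, lifting) UNIV_I image_eqI restrict_PiE_iff)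
  moreover have "finite (PiE ?L (\<lambda>_. UNIV :: 'k set))"
    using L by (intro finite_PiE) auto
  ultimately show ?thesis
    by (meson finite_imageI finite_subset)
qed

end

theory Submission
  imports Defs
begin

text \<open>
  Conditioning on \<open>X\<^sub>1\<close>, a policy for \<open>n + 1\<close> stages from \<open>q\<close> induces for every value \<open>j\<close> of
  \<open>X\<^sub>1\<close> an \<open>n\<close>-stage policy from \<open>m\<^sub>j\<close>: it starts with the signal that \<open>X\<^sub>1 = j\<close> would have
  produced. Hence \<open>v\<^bsub>n+1\<^esub>(q) \<le> \<Sum>\<^sub>j q(j) v\<^sub>n(m\<^sub>j)\<close>. Averaging this over the rows \<open>q = m\<^sub>i\<close> with
  weights \<open>\<pi>(i)\<close> and using \<open>\<pi> M = \<pi>\<close> gives the claim.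
\<close>

text \<open>A function of the first \<open>n + 1\<close> coordinates is a finite combination of
  indicators of cylinders, and \<open>measure_chain_law\<close> gives their probabilities.\<close>

lemma integral_chain_law:
  fixes q :: "'k::finite pmf" and f :: "(nat \<Rightarrow> 'k) \<Rightarrow> real"
  assumes f: "\<And>\<omega>. f \<omega> = f (restrict \<omega> {..n})"
  shows "(\<integral>\<omega>. f \<omega> \<partial>chain_law q M) =
    (\<Sum>x\<in>PiE {..n} (\<lambda>_. UNIV). f x * (pmf q (x 0) * (\<Prod>i<n. pmf (M (x i)) (x (Suc i)))))"
proof -
  interpret prob_space "chain_law q M" by (rule prob_space_chain_law)
  let ?X = "PiE {..n} (\<lambda>_. UNIV :: 'k set)"
  let ?A = "\<lambda>x. {\<omega>. \<forall>i\<le>n. \<omega> i = x i}"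
  have fin: "finite ?X" by (simp add: finite_PiE)
  have A: "?A x \<in> sets (chain_law q M)" for x
  proof -
    have "?A x = (\<Inter>i\<in>{..n}. (\<lambda>\<omega>. \<omega> i) -` {x i} \<inter> space (Pi\<^sub>M UNIV (\<lambda>_. count_space UNIV)))"
      by (auto simp: space_PiM)
    also have "\<dots> \<in> sets (Pi\<^sub>M UNIV (\<lambda>_. count_space UNIV))"
      by (intro sets.finite_INT measurable_sets[OF measurable_component_singleton]) auto
    finally show ?thesis by (simp add: sets_chain_law)
  qed
  \<comment> \<open>Exactly one cylinder indexed by \<open>?X\<close> contains
    \<open>\<omega>\<close>: that of its own restriction.\<close>
  have "f \<omega> = (\<Sum>x\<in>?X. f x * indicator (?A x) \<omega>)" for \<omega>
  proof -
    have "indicator (?A x) \<omega> = (if x = restrict \<omega> {..n} then 1 else 0 :: real)" if "x \<in> ?X" for x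
    proof -
      have "(\<forall>i\<le>n. \<omega> i = x i) \<longleftrightarrow> x = restrict \<omega> {..n}"
        using that by (auto simp: fun_eq_iff PiE_def extensional_def)
      then show ?thesis by (simp add: indicator_def)
    qed
    then have "(\<Sum>x\<in>?X. f x * indicator (?A x) \<omega>) =
        (\<Sum>x\<in>?X. if x = restrict \<omega> {..n} then f x else 0)"
      by (intro sum.cong) auto
    also have "\<dots> = f (restrict \<omega> {..n})"
      using fin by (simp add: restrict_PiE_iff)
    also have "\<dots> = f \<omega>" by (rule f[symmetric])
    finally show ?thesis ..
  qed
  then have "(\<integral>\<omega>. f \<omega> \<partial>chain_law q M) =
      (\<integral>\<omega>. (\<Sum>x\<in>?X. f x * indicator (?A x) \<omega>) \<partial>chain_law q M)"
    by (rule Bochner_Integration.integral_cong[OF refl])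
  also have "\<dots> = (\<Sum>x\<in>?X. f x * measure (chain_law q M) (?A x))"
    using A by (subst Bochner_Integration.integral_sum)
      (auto simp: emeasure_eq_measure integrable_real_indicator)
  finally show ?thesis by (simp only: measure_chain_law)
qed

lemma PiE_atMost_Suc:
  "PiE {..Suc n} (\<lambda>_. A) = (\<lambda>(a, x). case_nat a x) ` (A \<times> PiE {..n} (\<lambda>_. A))"
proof (intro equalityI subsetI)
  fix x assume x: "x \<in> PiE {..Suc n} (\<lambda>_. A)"
  then have "x = case_nat (x 0) (x \<circ> Suc)" "x 0 \<in> A" "x \<circ> Suc \<in> PiE {..n} (\<lambda>_. A)"
    by (auto simp: fun_eq_iff PiE_iff extensional_def split: nat.split)
  then show "x \<in> (\<lambda>(a, x). case_nat a x) ` (A \<times> PiE {..n} (\<lambda>_. A))"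
    by (intro image_eqI[of _ _ "(x 0, x \<circ> Suc)"]) auto
qed (auto simp: PiE_iff extensional_def split: nat.split)

text \<open>Markov property at the first step: given the initial state \<open>j\<close>, the shifted
  trajectory is a chain started from row \<open>M j\<close>, and \<open>case_nat j\<close> puts
  \<open>j\<close> back in front.\<close>

lemma integral_chain_law_case_nat:
  fixes q :: "'k::finite pmf" and f :: "(nat \<Rightarrow> 'k) \<Rightarrow> real"
  assumes f: "\<And>\<omega>. f \<omega> = f (restrict \<omega> {..Suc n})"
  shows "(\<integral>\<omega>. f \<omega> \<partial>chain_law q M) =
    (\<Sum>j\<in>UNIV. pmf q j * (\<integral>\<omega>. f (case_nat j \<omega>) \<partial>chain_law (M j) M))"
proof -
  let ?X = "\<lambda>n. PiE {..n} (\<lambda>_. UNIV :: 'k set)"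
  have inj: "inj_on (\<lambda>(a, x). case_nat a x) (UNIV \<times> ?X n)"
  proof (intro inj_onI, clarify, intro conjI)
    fix a a' :: 'k and x x' assume eq: "case_nat a x = case_nat a' x'"
    show "a = a'" using fun_cong[OF eq, of 0] by simp
    show "x = x'" using fun_cong[OF eq, of "Suc _"] by (simp add: fun_eq_iff)
  qed
  have f': "f (case_nat j \<omega>) = f (case_nat j (restrict \<omega> {..n}))" for j \<omega>
  proof -
    have "restrict (case_nat j \<omega>) {..Suc n} = restrict (case_nat j (restrict \<omega> {..n})) {..Suc n}"
      by (auto simp: fun_eq_iff restrict_def split: nat.split)
    then show ?thesis by (metis f)
  qed
  have "(\<integral>\<omega>. f \<omega> \<partial>chain_law q M) =
      (\<Sum>x\<in>?X (Suc n). f x * (pmf q (x 0) * (\<Prod>i<Suc n. pmf (M (x i)) (x (Suc i)))))"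
    by (rule integral_chain_law) (rule f)
  \<comment> \<open>Splitting off the first coordinate turns the first transition factor into
    \<open>pmf (M j) (x 0)\<close>, the initial mass of the chain started from
    \<open>M j\<close>.\<close>
  also have "\<dots> = (\<Sum>(j, x)\<in>UNIV \<times> ?X n. f (case_nat j x) *
      (pmf q j * (pmf (M j) (x 0) * (\<Prod>i<n. pmf (M (x i)) (x (Suc i))))))"
    unfolding PiE_atMost_Suc
    by (subst sum.reindex[OF inj], rule sum.cong)
      (auto simp: prod.lessThan_Suc_shift simp del: prod.lessThan_Suc)
  also have "\<dots> = (\<Sum>j\<in>UNIV. pmf q j * (\<integral>\<omega>. f (case_nat j \<omega>) \<partial>chain_law (M j) M))"
    by (simp add: integral_chain_law[where f = "\<lambda>\<omega>. f (case_nat _ \<omega>)" and n = n, OF f']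
        sum.cartesian_product[symmetric] sum_distrib_left mult.left_commute)
  finally show ?thesis .
qed

text \<open>A history of length \<open>j\<close> reads only coordinates below \<open>j\<close>,
  hence the bound \<open>Suc n\<close> for a restriction to \<open>{..n}\<close>.\<close>

lemma history_restrict:
  "j \<le> Suc n \<Longrightarrow> history \<xi> (restrict \<omega> {..n}) j = history \<xi> \<omega> j"
  by (induction j) (auto simp: Let_def state_def)

text \<open>The first pair depends on the trajectory only through \<open>x\<close>; with
  \<open>x\<close> fixed, it can be built into the policy that faces the shifted trajectory.\<close>

lemma history_case_nat:
  "history \<xi> (case_nat x \<omega>) (Suc j) =
    (\<xi> [], x = \<xi> []) # history (\<lambda>h. \<xi> ((\<xi> [], x = \<xi> []) # h)) \<omega> j"
proof (induction j)
  case (Suc j)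
  show ?case
    by (subst history.simps(2), subst Suc.IH) (simp add: Let_def state_def)
qed (simp add: Let_def state_def)

lemma payoff_Suc:
  fixes q :: "'k::finite pmf"
  assumes "n \<ge> 1"
  shows "payoff M u (Suc n) q \<xi> =
    (\<Sum>j\<in>UNIV. pmf q j * payoff M u n (M j) (\<lambda>h. \<xi> ((\<xi> [], j = \<xi> []) # h)))"
proof -
  \<comment> \<open>Stage \<open>Suc n\<close> reads coordinates up to \<open>Suc m\<close>. For
    \<open>n = 0\<close> the truncated \<open>n - 1\<close> would make the right-hand side evaluate
    the second state instead of the first.\<close>
  obtain m where n: "n = Suc m" using assms by (cases n) auto
  show ?thesis
    unfolding payoff_def
    by (subst integral_chain_law_case_nat[where n = m])
      (simp_all add: n action_def state_def history_restrict history_case_nat del: history.simps)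
qed

lemma payoff_le_val:
  fixes q :: "'k::finite pmf"
  shows "payoff M u n q \<xi> \<le> val M u n q"
  unfolding val_def by (rule Max_ge) (auto intro: finite_range_payoff)

text \<open>The continuation policies for different \<open>j\<close> are bounded by
  \<open>val\<close> separately, as if the first state were revealed; hence only an
  inequality.\<close>

lemma val_Suc_le:
  fixes q :: "'k::finite pmf"
  assumes "n \<ge> 1"
  shows "val M u (Suc n) q \<le> (\<Sum>j\<in>UNIV. pmf q j * val M u n (M j))"
proof -
  have "payoff M u (Suc n) q \<xi> \<le> (\<Sum>j\<in>UNIV. pmf q j * val M u n (M j))" for \<xi>
    unfolding payoff_Suc[OF assms] by (intro sum_mono mult_left_mono payoff_le_val pmf_nonneg)
  then show ?thesis
    unfolding val_def[of M u "Suc n"] by (subst Max_le_iff) (auto intro: finite_range_payoff)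
qed

lemma Phi_Suc_le:
  assumes "invariant M \<pi>" and "n \<ge> 1"
  shows "Phi M u (Suc n) \<pi> \<le> Phi M u n \<pi>"
proof -
  have "Phi M u (Suc n) \<pi> \<le> (\<Sum>i\<in>UNIV. pmf \<pi> i * (\<Sum>j\<in>UNIV. pmf (M i) j * val M u n (M j)))"
    unfolding Phi_def by (intro sum_mono mult_left_mono val_Suc_le assms pmf_nonneg)
  \<comment> \<open>After exchanging the sums, the inner one is the mass of \<open>j\<close> under
    \<open>\<pi> M\<close>, which invariance reduces to \<open>pmf \<pi> j\<close>.\<close>
  also have "\<dots> = (\<Sum>j\<in>UNIV. (\<Sum>i\<in>UNIV. pmf \<pi> i * pmf (M i) j) * val M u n (M j))"
    unfolding sum_distrib_left sum_distrib_right by (subst sum.swap) (simp add: mult.assoc)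
  also have "\<dots> = Phi M u n \<pi>"
    using assms by (simp add: invariant_def Phi_def)
  finally show ?thesis .
qed

theorem proposition2:
  fixes M :: "'k::finite \<Rightarrow> 'k pmf" and u :: "'k \<Rightarrow> 'k \<Rightarrow> real" and \<pi> :: "'k pmf"
  assumes "\<And>x a. 0 \<le> u x a \<and> u x a \<le> 1"
    and "invariant M \<pi>"
  shows "antimono_on {1..} (\<lambda>n. Phi M u n \<pi>)"
proof (rule monotone_onI)
  fix m n :: nat assume "m \<in> {1..}" and "m \<le> n"
  from \<open>m \<le> n\<close> show "Phi M u n \<pi> \<le> Phi M u m \<pi>"
  proof (induction n rule: dec_induct)
    case (step n)
    then have "Phi M u (Suc n) \<pi> \<le> Phi M u n \<pi>"
      using \<open>m \<in> {1..}\<close> by (intro Phi_Suc_le assms) auto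
    with step.IH show ?case by simp
  qed simp
qed

end
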